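(* Let $\alpha,\beta>0$ be the marginal costs of two firms, $r:=\alpha/\beta$, and consider the two-firm Best Response dynamics $$x^{t+1}=\sqrt{y^t/\alpha}-y^t,\qquad y^{t+1}=\sqrt{x^t/\beta}-x^t .$$ Let $(x^*,y^* )$ be the unique equilibrium (the unique fixed point with positive coordinates), and let $r_0:=3+2\sqrt2$. Then the evolution of the sequence $(x^t,y^t)$ around $(x^*,y^* )$, in the sense of the first-order linear approximation of the system at $(x^*,y^* )$, is as follows. (1) If $r_0^{-1}<r<r_0$, the effort levels spiral inwards towards the equilibrium ($(x^*,y^* )$ is a stable spiral focus). (2) If $r=r_0^{-1}$ or $r=r_0$, the effort levels cycle around the equilibrium ($(x^*,y^* )$ is a neutral center). (3) If $r<r_0^{-1}$ or $r>r_0$, the effort levels spiral outwards away from the equilibrium ($(x^*,y^* )$ is an unstable spiral focus).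
   Context: The dynamics arise from the two-firm, one-good Tullock contest (Cournot duopoly with isoelastic demand), where the firms have utilities $x/(x+y)-\alpha x$ and $y/(x+y)-\beta y$, and each firm simultaneously plays the unconstrained best response to the other firm's previous output. The classification refers to the linearization: let $J$ be the Jacobian matrix at $(x^*,y^* )$ of the map $(x,y)\mapsto(\sqrt{y/\alpha}-y,\ \sqrt{x/\beta}-x)$. When the eigenvalues of $J$ form a complex conjugate, purely imaginary pair $\pm i\mu$, $\mu\ge0$ (with $\mu=0$ allowed as a degenerate case), the equilibrium is called a stable spiral focus (trajectories of the linearized system oscillate inwards) if the common modulus $\mu$ is less than $1$, a neutral center (trajectories of the linearized system cycle) if it equals $1$, and an unstable spiral focus (trajectories of the linearized system oscillate outwards) if it is greater than $1$. *)

theory Defs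
  imports "HOL-Analysis.Analysis"
begin

text \<open>The two-firm Tullock contest has utilities \<open>x / (x + y) - \<alpha> * x\<close> and
  \<open>y / (x + y) - \<beta> * y\<close>. Against a positive output of the opponent, the first-order
  condition \<open>y / (x + y)^2 = \<alpha>\<close> gives the unconstrained best response
  \<open>x = sqrt (y / \<alpha>) - y\<close>, and symmetrically for the other firm. A state is the pair of
  outputs, the output \<open>x\<close> being component 1 and \<open>y\<close> being component 2.\<close>

definition best_response_map :: "real \<Rightarrow> real \<Rightarrow> real ^ 2 \<Rightarrow> real ^ 2" where
  "best_response_map \<alpha> \<beta> p = vector [sqrt (p $ 2 / \<alpha>) - p $ 2, sqrt (p $ 1 / \<beta>) - p $ 1]"

text \<open>The origin is also a fixed point, whence the positivity requirement.\<close>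

definition is_equilibrium :: "real \<Rightarrow> real \<Rightarrow> real ^ 2 \<Rightarrow> bool" where
  "is_equilibrium \<alpha> \<beta> p \<longleftrightarrow> p $ 1 > 0 \<and> p $ 2 > 0 \<and> best_response_map \<alpha> \<beta> p = p"

definition complex_eigenvalues :: "real ^ 'n ^ 'n \<Rightarrow> complex set" where
  "complex_eigenvalues A = {c. \<exists>v. v \<noteq> 0 \<and> map_matrix complex_of_real A *v v = c *s v}"

definition imaginary_pair :: "real ^ 2 ^ 2 \<Rightarrow> real \<Rightarrow> bool" where
  "imaginary_pair J \<mu> \<longleftrightarrow>
     \<mu> \<ge> 0 \<and> complex_eigenvalues J = {\<i> * complex_of_real \<mu>, - (\<i> * complex_of_real \<mu>)}"

definition stable_spiral_focus :: "(real ^ 2 \<Rightarrow> real ^ 2) \<Rightarrow> real ^ 2 \<Rightarrow> bool" where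
  "stable_spiral_focus F p \<longleftrightarrow> (\<exists>\<mu>. imaginary_pair (jacobian F (at p)) \<mu> \<and> \<mu> < 1)"

definition neutral_center :: "(real ^ 2 \<Rightarrow> real ^ 2) \<Rightarrow> real ^ 2 \<Rightarrow> bool" where
  "neutral_center F p \<longleftrightarrow> (\<exists>\<mu>. imaginary_pair (jacobian F (at p)) \<mu> \<and> \<mu> = 1)"

definition unstable_spiral_focus :: "(real ^ 2 \<Rightarrow> real ^ 2) \<Rightarrow> real ^ 2 \<Rightarrow> bool" where
  "unstable_spiral_focus F p \<longleftrightarrow> (\<exists>\<mu>. imaginary_pair (jacobian F (at p)) \<mu> \<and> \<mu> > 1)"

definition linearized_trajectory ::
    "(real ^ 2 \<Rightarrow> real ^ 2) \<Rightarrow> real ^ 2 \<Rightarrow> (nat \<Rightarrow> real ^ 2) \<Rightarrow> bool" where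
  "linearized_trajectory F p z \<longleftrightarrow>
     (\<forall>t. z (Suc t) = F p + jacobian F (at p) *v (z t - p))"

text \<open>Each coordinate keeps crossing its value at \<open>p\<close>. The second alternative is needed for
  the degenerate case \<open>\<mu> = 0\<close>, in which trajectories land on \<open>p\<close>.\<close>

definition oscillates_around :: "real ^ 2 \<Rightarrow> (nat \<Rightarrow> real ^ 2) \<Rightarrow> bool" where
  "oscillates_around p z \<longleftrightarrow>
     (\<forall>t i. z t $ i \<noteq> p $ i \<longrightarrow>
        (\<exists>s>t. (z s $ i - p $ i) * (z t $ i - p $ i) < 0) \<or> (\<exists>s>t. z s = p))"

definition spirals_inwards :: "real ^ 2 \<Rightarrow> (nat \<Rightarrow> real ^ 2) \<Rightarrow> bool" where
  "spirals_inwards p z \<longleftrightarrow> oscillates_around p z \<and> z \<longlonglongrightarrow> p"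

definition cycles_around :: "real ^ 2 \<Rightarrow> (nat \<Rightarrow> real ^ 2) \<Rightarrow> bool" where
  "cycles_around p z \<longleftrightarrow> oscillates_around p z \<and> (\<exists>n>0. \<forall>t. z (t + n) = z t)"

definition spirals_outwards :: "real ^ 2 \<Rightarrow> (nat \<Rightarrow> real ^ 2) \<Rightarrow> bool" where
  "spirals_outwards p z \<longleftrightarrow>
     oscillates_around p z \<and> filterlim (\<lambda>t. dist (z t) p) at_top sequentially"

end

theory Submission
  imports Defs
begin

text \<open>At the equilibrium \<open>(\<beta>, \<alpha>) / (\<alpha> + \<beta>)\<^sup>2\<close> the Jacobian is antidiagonal, because each firm
  reacts only to its opponent, and the product of its two entries is \<open>- \<mu>\<^sup>2\<close> for
  \<open>\<mu> = \<bar>\<alpha> - \<beta>\<bar> / (2 * sqrt (\<alpha> * \<beta>))\<close>. Hence the eigenvalues are \<open>\<plusminus> \<i> * \<mu>\<close>, and every second step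
  of the linearized system multiplies the deviation from the equilibrium by \<open>- \<mu>\<^sup>2\<close>. Finally
  \<open>\<mu> < 1\<close> means \<open>r\<^sup>2 - 6 * r + 1 < 0\<close>, a quadratic with the roots \<open>r\<^sub>0\<close> and \<open>inverse r\<^sub>0\<close>.\<close>

section \<open>Jacobian and spectrum of a planar map that swaps the coordinates\<close>

lemma jacobian_swap_map:
  fixes f g :: "real \<Rightarrow> real" and p :: "real ^ 2"
  assumes f: "(f has_real_derivative a) (at (p $ 2))"
    and g: "(g has_real_derivative b) (at (p $ 1))"
  shows "jacobian (\<lambda>q. vector [f (q $ 2), g (q $ 1)] :: real ^ 2) (at p) =
    vector [vector [0, a], vector [b, 0]]"
proof -
  let ?F = "\<lambda>q :: real ^ 2. vector [f (q $ 2), g (q $ 1)] :: real ^ 2"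
  let ?D = "\<lambda>h :: real ^ 2. vector [a * h $ 2, b * h $ 1] :: real ^ 2"
  have nth: "((\<lambda>q. q $ i) has_derivative (\<lambda>h. h $ i)) (at p)" for i :: 2
    by (intro bounded_linear_imp_has_derivative bounded_linear_vec_nth)
  have "((\<lambda>q. f (q $ 2)) has_derivative (\<lambda>h. a * h $ 2)) (at p)"
    using has_derivative_compose[OF nth has_field_derivative_imp_has_derivative[OF f]] by simp
  moreover have "((\<lambda>q. g (q $ 1)) has_derivative (\<lambda>h. b * h $ 1)) (at p)"
    using has_derivative_compose[OF nth has_field_derivative_imp_has_derivative[OF g]] by simp
  ultimately have "((\<lambda>q. ?F q $ i) has_derivative (\<lambda>h. ?D h $ i)) (at p)" for i
    using exhaust_2[of i] by auto
  \<comment> \<open>The componentwise criterion tests inner products with basis vectors;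
    \<open>Basis_vec_def\<close> and \<open>inner_axis\<close> turn these into the coordinates just
    treated.\<close>
  then have "(?F has_derivative ?D) (at p)"
    by (subst has_derivative_componentwise_within) (auto simp: Basis_vec_def inner_axis)
  then have "frechet_derivative ?F (at p) = ?D"
    by (rule frechet_derivative_at[symmetric])
  then show ?thesis
    by (simp add: jacobian_def matrix_def vec_eq_iff forall_2 axis_def)
qed

text \<open>The square of an antidiagonal matrix is the scalar \<open>a * b\<close>, which restricts
  its eigenvalues; conversely each square root of \<open>a * b\<close> has an explicit
  eigenvector.\<close>

lemma complex_eigenvalues_antidiagonal:
  fixes a b :: real
  shows "complex_eigenvalues (vector [vector [0, a], vector [b, 0]] :: real ^ 2 ^ 2) =
    {c. c\<^sup>2 = complex_of_real (a * b)}"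
proof -
  let ?A = "vector [vector [0, a], vector [b, 0]] :: real ^ 2 ^ 2"
  have eigen: "map_matrix complex_of_real ?A *v v = c *s v \<longleftrightarrow>
      of_real a * v $ 2 = c * v $ 1 \<and> of_real b * v $ 1 = c * v $ 2" for c v
    by (simp add: vec_eq_iff forall_2 matrix_vector_mult_def sum_2 map_matrix_def)
  have "c\<^sup>2 = of_real (a * b)"
    if "v \<noteq> 0" "of_real a * v $ 2 = c * v $ 1" "of_real b * v $ 1 = c * v $ 2"
    for c and v :: "complex ^ 2"
  proof -
    \<comment> \<open>Substituting each eigenvector equation into the other. Both coordinates are
      kept because only one of them is known to be nonzero and can be cancelled.\<close>
    have "c\<^sup>2 * v $ 1 = of_real (a * b) * v $ 1" "c\<^sup>2 * v $ 2 = of_real (a * b) * v $ 2"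
      using that(2,3) unfolding of_real_mult by algebra+
    moreover have "v $ 1 \<noteq> 0 \<or> v $ 2 \<noteq> 0"
      using that(1) by (auto simp: vec_eq_iff forall_2)
    ultimately show ?thesis by auto
  qed
  moreover have "\<exists>v :: complex ^ 2. v \<noteq> 0 \<and> of_real a * v $ 2 = c * v $ 1 \<and> of_real b * v $ 1 = c * v $ 2"
    if "c\<^sup>2 = of_real (a * b)" for c
  \<comment> \<open>The vector \<open>(a, c)\<close> solves both equations but vanishes if
    \<open>a = 0\<close>, since then \<open>c = 0\<close> too. In that case \<open>(0, 1)\<close>
    lies in the kernel.\<close>
  proof (cases "a = 0")
    case True
    with that show ?thesis
      by (intro exI[of _ "vector [0, 1]"]) (auto simp: vec_eq_iff forall_2)
  next
    case False
    with that show ?thesis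
      by (intro exI[of _ "vector [of_real a, c]"])
        (auto simp: vec_eq_iff forall_2 power2_eq_square mult.commute)
  qed
  ultimately show ?thesis
    unfolding complex_eigenvalues_def eigen by blast
qed

text \<open>The eigenvalue set determines \<mu> only up to sign; the nonnegativity inside
  \<open>imaginary_pair\<close> fixes the sign. Uniqueness lets the existential over the modulus in
  each type of focus collapse to a condition on \<mu>.\<close>

lemma imaginary_pair_antidiagonal_iff:
  assumes "a * b = - \<mu>\<^sup>2" and "\<mu> \<ge> 0"
  shows "imaginary_pair (vector [vector [0, a], vector [b, 0]]) \<nu> \<longleftrightarrow> \<nu> = \<mu>"
proof -
  have "c\<^sup>2 = complex_of_real (a * b) \<longleftrightarrow> c = \<i> * of_real \<mu> \<or> c = - (\<i> * of_real \<mu>)" for c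
    using power2_eq_iff[of c "\<i> * of_real \<mu>"] by (simp add: assms(1) power_mult_distrib)
  then have "complex_eigenvalues (vector [vector [0, a], vector [b, 0]] :: real ^ 2 ^ 2) =
      {\<i> * of_real \<mu>, - (\<i> * of_real \<mu>)}"
    unfolding complex_eigenvalues_antidiagonal by blast
  with assms(2) show ?thesis
    by (auto simp: imaginary_pair_def doubleton_eq_iff complex_eq_iff)
qed

section \<open>Orbits whose second iterate is a scalar multiple\<close>

lemma antidiagonal_orbit_two_step:
  fixes w :: "nat \<Rightarrow> real ^ 2"
  assumes "\<And>t. w (Suc t) = vector [vector [0, a], vector [b, 0]] *v w t"
  shows "w (Suc (Suc t)) = (a * b) *\<^sub>R w t"
  unfolding assms by (simp add: vec_eq_iff forall_2 matrix_vector_mult_def sum_2)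

text \<open>Even and odd times form two independent geometric sequences: \<open>t mod 2\<close>
  selects the starting vector and \<open>t div 2\<close> counts the double steps.\<close>

lemma two_step_orbit:
  fixes w :: "nat \<Rightarrow> 'a::real_vector"
  assumes "\<And>t. w (Suc (Suc t)) = c *\<^sub>R w t"
  shows "w t = c ^ (t div 2) *\<^sub>R w (t mod 2)"
proof (induction t rule: less_induct)
  case (less t)
  show ?case
  proof (cases "t < 2")
    case False
    then obtain s where "t = Suc (Suc s)"
      by (metis add_2_eq_Suc le_add_diff_inverse not_less)
    with less[of s] show ?thesis
      by (simp add: assms mod_Suc)
  qed auto
qed

lemma filterlim_div_2: "filterlim (\<lambda>t::nat. t div 2) at_top sequentially"
proof (subst filterlim_at_top, intro allI)
  show "\<forall>\<^sub>F t in sequentially. k \<le> t div 2" for k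
    using eventually_ge_at_top[of "2 * k"] by eventually_elim linarith
qed

text \<open>The factor \<open>- \<mu>\<^sup>2\<close> flips the sign of each nonzero coordinate
  deviation, so the time \<open>t + 2\<close> is a witness; for \<open>\<mu> = 0\<close> the orbit
  is at \<open>p\<close> by that time.\<close>

lemma oscillates_around_two_step:
  fixes z :: "nat \<Rightarrow> real ^ 2"
  assumes "\<And>t. z (Suc (Suc t)) - p = (- \<mu>\<^sup>2) *\<^sub>R (z t - p)"
  shows "oscillates_around p z"
  unfolding oscillates_around_def
proof (intro allI impI)
  fix t i
  assume neq: "z t $ i \<noteq> p $ i"
  show "(\<exists>s>t. (z s $ i - p $ i) * (z t $ i - p $ i) < 0) \<or> (\<exists>s>t. z s = p)"
  proof (cases "\<mu> = 0")
    case True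
    then have "z (Suc (Suc t)) = p"
      using assms[of t] by simp
    then show ?thesis
      by (metis less_Suc_eq)
  next
    case False
    have "z (Suc (Suc t)) $ i - p $ i = - \<mu>\<^sup>2 * (z t $ i - p $ i)"
      using arg_cong[OF assms[of t], of "\<lambda>v. v $ i"] by simp
    then have "(z (Suc (Suc t)) $ i - p $ i) * (z t $ i - p $ i) = - ((\<mu> * (z t $ i - p $ i))\<^sup>2)"
      by (simp only:) (simp add: power2_eq_square)
    also have "\<dots> < 0"
      using False neq by simp
    finally show ?thesis
      by (metis less_Suc_eq)
  qed
qed

lemma two_step_spirals_inwards:
  fixes z :: "nat \<Rightarrow> real ^ 2"
  assumes step: "\<And>t. z (Suc (Suc t)) - p = (- \<mu>\<^sup>2) *\<^sub>R (z t - p)"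
    and "\<bar>\<mu>\<bar> < 1"
  shows "spirals_inwards p z"
proof -
  \<comment> \<open>Bounds both starting deviations, so that one geometric estimate serves both
    parities.\<close>
  let ?C = "norm (z 0 - p) + norm (z 1 - p)"
  have "norm (z t - p) \<le> (\<mu>\<^sup>2) ^ (t div 2) * ?C" for t
  proof -
    have "norm (z (t mod 2) - p) \<le> ?C"
      by (cases "t mod 2 = 0") (auto simp: not_mod_2_eq_0_eq_1)
    then show ?thesis
      by (subst two_step_orbit[of "\<lambda>t. z t - p", OF step])
        (auto simp: power_abs intro!: mult_left_mono)
  qed
  moreover have "(\<lambda>t. (\<mu>\<^sup>2) ^ (t div 2) * ?C) \<longlonglongrightarrow> 0"
  proof (rule tendsto_mult_left_zero)
    have "norm (\<mu>\<^sup>2) < 1"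
      using assms(2) by (simp add: abs_square_less_1)
    from filterlim_compose[OF LIMSEQ_power_zero[OF this] filterlim_div_2]
    show "(\<lambda>t. (\<mu>\<^sup>2) ^ (t div 2)) \<longlonglongrightarrow> 0" .
  qed
  ultimately have "(\<lambda>t. z t - p) \<longlonglongrightarrow> 0"
    by (rule Lim_null_comparison[OF always_eventually, OF allI])
  then show ?thesis
    using oscillates_around_two_step[of z p \<mu>, OF step] by (simp add: spirals_inwards_def LIM_zero_iff)
qed

text \<open>Two steps negate the deviation, hence four steps restore it.\<close>

lemma two_step_cycles:
  fixes z :: "nat \<Rightarrow> real ^ 2"
  assumes step: "\<And>t. z (Suc (Suc t)) - p = (- \<mu>\<^sup>2) *\<^sub>R (z t - p)"
    and "\<bar>\<mu>\<bar> = 1"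
  shows "cycles_around p z"
proof -
  have "\<mu>\<^sup>2 = 1"
    using assms(2) by (metis power2_abs one_power2)
  then have "z (Suc (Suc (Suc (Suc t)))) - p = z t - p" for t
    by (simp only: step) simp
  then have "\<forall>t. z (t + 4) = z t"
    by (simp add: eval_nat_numeral)
  then show ?thesis
    using oscillates_around_two_step[of z p \<mu>, OF step] unfolding cycles_around_def
    by (meson zero_less_numeral)
qed

text \<open>Both starting deviations must be nonzero: if one parity rested at \<open>p\<close>, the
  distance could not tend to infinity.\<close>

lemma two_step_spirals_outwards:
  fixes z :: "nat \<Rightarrow> real ^ 2"
  assumes step: "\<And>t. z (Suc (Suc t)) - p = (- \<mu>\<^sup>2) *\<^sub>R (z t - p)"
    and "\<bar>\<mu>\<bar> > 1" and "z 0 \<noteq> p" and "z 1 \<noteq> p"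
  shows "spirals_outwards p z"
proof -
  let ?c = "min (norm (z 0 - p)) (norm (z 1 - p))"
  have "(\<mu>\<^sup>2) ^ (t div 2) * ?c \<le> dist (z t) p" for t
  proof -
    have "?c \<le> norm (z (t mod 2) - p)"
      by (cases "t mod 2 = 0") (auto simp: not_mod_2_eq_0_eq_1)
    then show ?thesis
      unfolding dist_norm
      by (subst two_step_orbit[of "\<lambda>t. z t - p", OF step])
        (auto simp: power_abs intro!: mult_left_mono)
  qed
  moreover have "filterlim (\<lambda>t. (\<mu>\<^sup>2) ^ (t div 2) * ?c) at_top sequentially"
  proof (rule filterlim_at_top_mult_tendsto_pos[OF tendsto_const])
    show "?c > 0"
      using assms(3,4) by simp
    have "\<mu>\<^sup>2 > 1"
      using assms(2) power_strict_mono[of 1 "\<bar>\<mu>\<bar>" 2] by simp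
    moreover have "\<mu>\<^sup>2 > 0"
      using \<open>\<mu>\<^sup>2 > 1\<close> by linarith
    \<comment> \<open>The powers diverge in absolute value; being positive, they diverge to
      \<open>at_top\<close>.\<close>
    ultimately have "filterlim (\<lambda>n. (\<mu>\<^sup>2) ^ n) at_top sequentially"
      by (intro filterlim_at_infinity_imp_filterlim_at_top filterlim_realpow_sequentially_gt1
          always_eventually allI zero_less_power[of "\<mu>\<^sup>2"]) simp_all
    from filterlim_compose[OF this filterlim_div_2]
    show "filterlim (\<lambda>t. (\<mu>\<^sup>2) ^ (t div 2)) at_top sequentially" .
  qed
  ultimately have "filterlim (\<lambda>t. dist (z t) p) at_top sequentially"
    by (rule filterlim_at_top_mono[OF _ always_eventually, OF _ allI, rotated])
  then show ?thesis
    using oscillates_around_two_step[of z p \<mu>, OF step] by (simp add: spirals_outwards_def)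
qed

section \<open>The equilibrium and its Jacobian\<close>

lemma is_equilibrium_iff:
  assumes "\<alpha> > 0" "\<beta> > 0"
  shows "is_equilibrium \<alpha> \<beta> p \<longleftrightarrow> p = vector [\<beta> / (\<alpha> + \<beta>)\<^sup>2, \<alpha> / (\<alpha> + \<beta>)\<^sup>2]"
proof
  assume p: "is_equilibrium \<alpha> \<beta> p"
  \<comment> \<open>Total output: both fixed point equations say that the square root equals
    \<open>s\<close>, so each output is the opponent's cost times \<open>s\<^sup>2\<close>, and
    summing the outputs determines \<open>s\<close>.\<close>
  define s where "s = p $ 1 + p $ 2"
  have "p $ 1 > 0" "p $ 2 > 0"
    using p by (simp_all add: is_equilibrium_def)
  then have s: "s > 0"
    by (simp add: s_def)
  have "sqrt (p $ 2 / \<alpha>) = s" "sqrt (p $ 1 / \<beta>) = s"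
    using p by (auto simp: is_equilibrium_def best_response_map_def vec_eq_iff forall_2 s_def)
  then have "p $ 2 / \<alpha> = s\<^sup>2" "p $ 1 / \<beta> = s\<^sup>2"
    using assms \<open>p $ 1 > 0\<close> \<open>p $ 2 > 0\<close> by (auto simp flip: \<open>sqrt (p $ 2 / \<alpha>) = s\<close>)
  then have xy: "p $ 2 = \<alpha> * s\<^sup>2" "p $ 1 = \<beta> * s\<^sup>2"
    using assms by (auto simp: field_simps)
  then have "\<beta> * s\<^sup>2 + \<alpha> * s\<^sup>2 = s"
    using s_def by linarith
  then have "s * ((\<alpha> + \<beta>) * s) = s * 1"
    by (simp add: power2_eq_square algebra_simps)
  \<comment> \<open>Cancelling \<open>s > 0\<close> discards the fixed point at the origin.\<close>
  then have "(\<alpha> + \<beta>) * s = 1"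
    using s by simp
  then have "s = 1 / (\<alpha> + \<beta>)"
    using assms by (simp add: field_simps)
  with xy show "p = vector [\<beta> / (\<alpha> + \<beta>)\<^sup>2, \<alpha> / (\<alpha> + \<beta>)\<^sup>2]"
    by (simp add: vec_eq_iff forall_2 power_divide)
next
  assume p: "p = vector [\<beta> / (\<alpha> + \<beta>)\<^sup>2, \<alpha> / (\<alpha> + \<beta>)\<^sup>2]"
  have "sqrt (1 / (\<alpha> + \<beta>)\<^sup>2) = (\<alpha> + \<beta>) / (\<alpha> + \<beta>)\<^sup>2"
    using assms by (simp add: real_sqrt_divide power2_eq_square)
  with p assms show "is_equilibrium \<alpha> \<beta> p"
    by (simp add: is_equilibrium_def best_response_map_def vec_eq_iff forall_2 add_divide_distrib)
qed

text \<open>Serves both firms: \<gamma> is the cost of the reacting firm, \<delta> that of its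
  opponent, and the base point is the opponent's equilibrium output. There the square root equals
  \<open>1 / (\<gamma> + \<delta>)\<close>, so the slope is
  \<open>(\<gamma> + \<delta>) / (2 * \<gamma>) - 1\<close>.\<close>

lemma has_derivative_best_response:
  assumes "\<gamma> > 0" and "\<delta> > 0"
  shows "((\<lambda>u. sqrt (u / \<gamma>) - u) has_real_derivative (\<delta> - \<gamma>) / (2 * \<gamma>)) (at (\<gamma> / (\<gamma> + \<delta>)\<^sup>2))"
proof -
  have "sqrt (1 / (\<gamma> + \<delta>)\<^sup>2) = 1 / (\<gamma> + \<delta>)"
    using assms by (simp add: real_sqrt_divide)
  moreover have "((\<lambda>u. sqrt (u / \<gamma>) - u) has_real_derivative
      inverse (sqrt (1 / (\<gamma> + \<delta>)\<^sup>2)) / 2 * (1 / \<gamma>) - 1) (at (\<gamma> / (\<gamma> + \<delta>)\<^sup>2))"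
    using assms by (auto intro!: derivative_eq_intros)
  ultimately show ?thesis
    using assms by (simp add: diff_divide_distrib add_divide_distrib)
qed

lemma jacobian_best_response_map:
  assumes "\<alpha> > 0" "\<beta> > 0" and "is_equilibrium \<alpha> \<beta> p"
  shows "jacobian (best_response_map \<alpha> \<beta>) (at p) =
    vector [vector [0, (\<beta> - \<alpha>) / (2 * \<alpha>)], vector [(\<alpha> - \<beta>) / (2 * \<beta>), 0]]"
  unfolding best_response_map_def
proof (rule jacobian_swap_map)
  have p: "p = vector [\<beta> / (\<alpha> + \<beta>)\<^sup>2, \<alpha> / (\<alpha> + \<beta>)\<^sup>2]"
    using assms is_equilibrium_iff by simp
  show "((\<lambda>u. sqrt (u / \<alpha>) - u) has_real_derivative (\<beta> - \<alpha>) / (2 * \<alpha>)) (at (p $ 2))"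
    using has_derivative_best_response[OF assms(1,2)] by (simp add: p)
  show "((\<lambda>u. sqrt (u / \<beta>) - u) has_real_derivative (\<alpha> - \<beta>) / (2 * \<beta>)) (at (p $ 1))"
    using has_derivative_best_response[OF assms(2,1)] by (simp add: p add.commute)
qed

section \<open>Thresholds for the cost ratio and the classification\<close>

lemma threshold_factorization:
  fixes r :: real
  shows "(r - 1)\<^sup>2 - 4 * r = (r - (3 + 2 * sqrt 2)) * (r - inverse (3 + 2 * sqrt 2))"
proof -
  \<comment> \<open>The conjugates multiply to \<open>9 - 8 = 1\<close>; their sum 6 matches the
    linear coefficient.\<close>
  have "inverse (3 + 2 * sqrt 2) = 3 - 2 * sqrt 2"
    by (rule inverse_unique) (simp add: algebra_simps)
  then show ?thesis
    by (simp only:) (simp add: power2_eq_square algebra_simps)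
qed

theorem proposition15:
  fixes \<alpha> \<beta> r r\<^sub>0 :: real
  assumes "\<alpha> > 0" and "\<beta> > 0"
    and "r = \<alpha> / \<beta>"
    and "r\<^sub>0 = 3 + 2 * sqrt 2"
  shows "(\<exists>!p. is_equilibrium \<alpha> \<beta> p) \<and>
    (\<forall>p. is_equilibrium \<alpha> \<beta> p \<longrightarrow>
      (inverse r\<^sub>0 < r \<and> r < r\<^sub>0 \<longrightarrow>
         stable_spiral_focus (best_response_map \<alpha> \<beta>) p \<and>
         (\<forall>z. linearized_trajectory (best_response_map \<alpha> \<beta>) p z \<and> z 0 \<noteq> p \<longrightarrow>
              spirals_inwards p z)) \<and>
      (r = inverse r\<^sub>0 \<or> r = r\<^sub>0 \<longrightarrow>
         neutral_center (best_response_map \<alpha> \<beta>) p \<and>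
         (\<forall>z. linearized_trajectory (best_response_map \<alpha> \<beta>) p z \<and> z 0 \<noteq> p \<longrightarrow>
              cycles_around p z)) \<and>
      (r < inverse r\<^sub>0 \<or> r > r\<^sub>0 \<longrightarrow>
         unstable_spiral_focus (best_response_map \<alpha> \<beta>) p \<and>
         (\<forall>z. linearized_trajectory (best_response_map \<alpha> \<beta>) p z \<and> z 0 \<noteq> p \<longrightarrow>
              spirals_outwards p z)))"
proof (rule conjI)
  show "\<exists>!p. is_equilibrium \<alpha> \<beta> p"
    using assms(1,2) by (simp add: is_equilibrium_iff)
next
  let ?F = "best_response_map \<alpha> \<beta>"
  define \<mu> where "\<mu> = \<bar>\<alpha> - \<beta>\<bar> / (2 * sqrt (\<alpha> * \<beta>))"
  have \<mu>_nonneg: "\<mu> \<ge> 0"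
    using assms(1,2) by (simp add: \<mu>_def)
  have \<mu>_sq: "\<mu>\<^sup>2 = (\<alpha> - \<beta>)\<^sup>2 / (4 * (\<alpha> * \<beta>))"
    using assms(1,2) by (simp add: \<mu>_def power_divide power_mult_distrib)
  \<comment> \<open>Dividing numerator and denominator of \<open>\<mu>\<^sup>2\<close> by
    \<open>\<beta>\<^sup>2\<close> gives \<open>(r - 1)\<^sup>2 / (4 * r)\<close>. As
    \<open>4 * r > 0\<close>, the sign of the factored quadratic compares \<mu> with 1.\<close>
  have "4 * r * (\<mu>\<^sup>2 - 1) = (r - 1)\<^sup>2 - 4 * r"
    unfolding \<mu>_sq assms(3) using assms(1,2) by (simp add: field_simps power2_eq_square)
  then have \<mu>_r: "4 * r * (\<mu>\<^sup>2 - 1) = (r - r\<^sub>0) * (r - inverse r\<^sub>0)"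
    by (simp add: threshold_factorization assms(4))
  have r_pos: "4 * r > 0"
    using assms(1-3) by simp
  \<comment> \<open>Orders the two roots, so that outside the interval between them both factors
    have the same sign.\<close>
  have r\<^sub>0: "inverse r\<^sub>0 < 1" "1 < r\<^sub>0"
    by (simp_all add: assms(4) inverse_less_1_iff add_pos_nonneg)
  have lt: "\<mu> < 1" if "inverse r\<^sub>0 < r" "r < r\<^sub>0"
  proof -
    have "4 * r * (\<mu>\<^sup>2 - 1) < 0"
      unfolding \<mu>_r using that by (intro mult_neg_pos) auto
    with r_pos have "\<mu>\<^sup>2 < 1"
      by (simp add: mult_less_0_iff)
    then show ?thesis
      by (simp add: abs_square_less_1)
  qed
  have eq: "\<mu> = 1" if "r = inverse r\<^sub>0 \<or> r = r\<^sub>0"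
  proof -
    have "4 * r * (\<mu>\<^sup>2 - 1) = 0"
      unfolding \<mu>_r using that by auto
    with r_pos have "\<mu>\<^sup>2 = 1"
      by simp
    with \<mu>_nonneg show ?thesis
      by (simp add: power2_eq_1_iff)
  qed
  have gt: "\<mu> > 1" if "r < inverse r\<^sub>0 \<or> r > r\<^sub>0"
  proof -
    have "4 * r * (\<mu>\<^sup>2 - 1) > 0"
      unfolding \<mu>_r using that r\<^sub>0 by (auto simp: zero_less_mult_iff)
    with r_pos have "\<mu>\<^sup>2 > 1"
      by (simp add: zero_less_mult_iff)
    with \<mu>_nonneg show ?thesis
      using power_le_one[of \<mu> 2] by linarith
  qed
  \<comment> \<open>With \<open>P\<close> arbitrary, the first fact yields all three types of focus
    by instantiation.\<close>
  have dynamics: "(\<exists>\<nu>. imaginary_pair (jacobian ?F (at p)) \<nu> \<and> P \<nu>) \<longleftrightarrow> P \<mu>"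
    "linearized_trajectory ?F p z \<Longrightarrow> z (Suc (Suc t)) - p = (- \<mu>\<^sup>2) *\<^sub>R (z t - p)"
    "linearized_trajectory ?F p z \<Longrightarrow> z t = p \<Longrightarrow> z (Suc t) = p"
    if p: "is_equilibrium \<alpha> \<beta> p" for p P z t
  proof -
    define a where "a = (\<beta> - \<alpha>) / (2 * \<alpha>)"
    define b where "b = (\<alpha> - \<beta>) / (2 * \<beta>)"
    have J: "jacobian ?F (at p) = vector [vector [0, a], vector [b, 0]]"
      using jacobian_best_response_map[OF assms(1,2) p] by (simp add: a_def b_def)
    have ab: "a * b = - \<mu>\<^sup>2"
      unfolding \<mu>_sq a_def b_def using assms(1,2) by (simp add: field_simps power2_eq_square)
    show "(\<exists>\<nu>. imaginary_pair (jacobian ?F (at p)) \<nu> \<and> P \<nu>) \<longleftrightarrow> P \<mu>"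
      by (simp add: J imaginary_pair_antidiagonal_iff[OF ab \<mu>_nonneg])
    assume z: "linearized_trajectory ?F p z"
    \<comment> \<open>Turns the affine linearization into a linear recursion for the deviation from
      \<open>p\<close>.\<close>
    have "?F p = p"
      using p by (simp add: is_equilibrium_def)
    then have step: "z (Suc t) - p = vector [vector [0, a], vector [b, 0]] *v (z t - p)" for t
      using z by (simp add: linearized_trajectory_def J)
    show "z (Suc (Suc t)) - p = (- \<mu>\<^sup>2) *\<^sub>R (z t - p)"
      using antidiagonal_orbit_two_step[of "\<lambda>t. z t - p", OF step] by (simp add: ab)
    show "z t = p \<Longrightarrow> z (Suc t) = p"
      using step[of t] by simp
  qed
  have outwards: "spirals_outwards p z"
    if p: "is_equilibrium \<alpha> \<beta> p" and z: "linearized_trajectory ?F p z" "z 0 \<noteq> p" and "\<mu> > 1" for p z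
  proof (rule two_step_spirals_outwards[of z p \<mu>, OF dynamics(2)[OF p z(1)]])
    \<comment> \<open>If the orbit were at \<open>p\<close> at time 1, it would be there at time 2
      as well; but the deviation at time 2 is \<open>- \<mu>\<^sup>2\<close> times the nonzero
      initial one.\<close>
    show "z 1 \<noteq> p"
    proof
      assume "z 1 = p"
      then have "z (Suc (Suc 0)) = p"
        using dynamics(3)[OF p z(1), of 1] by simp
      then show False
        using dynamics(2)[OF p z(1), of 0] z(2) \<open>\<mu> > 1\<close> by simp
    qed
  qed (use that in auto)
  have inwards: "spirals_inwards p z"
    if "is_equilibrium \<alpha> \<beta> p" "linearized_trajectory ?F p z" "\<mu> < 1" for p z
    using that(3) \<mu>_nonneg
    by (intro two_step_spirals_inwards[of z p \<mu>, OF dynamics(2)[OF that(1,2)]]) simp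
  have cycles: "cycles_around p z"
    if "is_equilibrium \<alpha> \<beta> p" "linearized_trajectory ?F p z" "\<mu> = 1" for p z
    using that(3) by (intro two_step_cycles[of z p \<mu>, OF dynamics(2)[OF that(1,2)]]) simp
  have foci: "stable_spiral_focus ?F p \<longleftrightarrow> \<mu> < 1" "neutral_center ?F p \<longleftrightarrow> \<mu> = 1"
    "unstable_spiral_focus ?F p \<longleftrightarrow> \<mu> > 1" if "is_equilibrium \<alpha> \<beta> p" for p
    unfolding stable_spiral_focus_def neutral_center_def unstable_spiral_focus_def
    by (rule dynamics(1)[OF that])+
  show "\<forall>p. is_equilibrium \<alpha> \<beta> p \<longrightarrow>
      (inverse r\<^sub>0 < r \<and> r < r\<^sub>0 \<longrightarrow>
         stable_spiral_focus ?F p \<and>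
         (\<forall>z. linearized_trajectory ?F p z \<and> z 0 \<noteq> p \<longrightarrow> spirals_inwards p z)) \<and>
      (r = inverse r\<^sub>0 \<or> r = r\<^sub>0 \<longrightarrow>
         neutral_center ?F p \<and>
         (\<forall>z. linearized_trajectory ?F p z \<and> z 0 \<noteq> p \<longrightarrow> cycles_around p z)) \<and>
      (r < inverse r\<^sub>0 \<or> r > r\<^sub>0 \<longrightarrow>
         unstable_spiral_focus ?F p \<and>
         (\<forall>z. linearized_trajectory ?F p z \<and> z 0 \<noteq> p \<longrightarrow> spirals_outwards p z))"
    using lt eq gt foci inwards cycles outwards by blast
qed

end
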